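(* Let $A$ be an $n$-generated MV-algebra. Then $A$ is projective if and only if $A$ is isomorphic to a subalgebra $B$ of $Free_n$ for which there is an epimorphism $\varphi:Free_n\to B$ such that, writing $g_1,\dots,g_n$ for the generators of $Free_n$, $d_i=\varphi(g_i)$ for $i=1,\dots,n$, and $$K=\{\mathbf{x}\in[0,1]^n : d_1(\mathbf{x})=g_1(\mathbf{x}),\dots,d_n(\mathbf{x})=g_n(\mathbf{x})\},$$ for every $\mathbf{u}\in[0,1]^n$ there is $\mathbf{x}\in K$ with $$d_1(\mathbf{u})=d_1(\mathbf{x}),\ \dots,\ d_n(\mathbf{u})=d_n(\mathbf{x}).$$
   Context: By convention, "MV-algebra" means semisimple MV-algebra, i.e. (up to isomorphism) a subalgebra of a direct power of the standard MV-algebra $[0,1]$. $Free_n$ is the free MV-algebra on $n$ generators, identified with the MV-algebra of McNaughton functions on $[0,1]^n$ (continuous functions $[0,1]^n\to[0,1]$, piecewise linear with finitely many pieces, each with integer coefficients; pointwise operations $x\oplus y=\min(1,x+y)$, $x'=1-x$, constant $0$). Its generators $g_1,\dots,g_n$ are the coordinate projections $g_i(\mathbf{x})=x_i$. Standing convention of the paper: generators $a$ of an MV-algebra of functions are assumed to satisfy $a(\mathbf{0})=0$ (here: $d_i(\mathbf{0})=0$). An MV-algebra $A$ is projective if for all MV-algebras $B,C$, every epimorphism (surjective homomorphism) $g:C\to B$ and every homomorphism $f:A\to B$, there is a homomorphism $h:A\to C$ with $g\circ h=f$. The set $K$ is called the equalizer of $B$. *)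

theory Defs
  imports
    "HOL-Analysis.Analysis"
    "HOL-Algebra.Congruence"
    "HOL-Library.Infinite_Typeclass"
begin

section \<open>MV-algebras\<close>

record 'a mv = "'a partial_object" +
  mplus :: "'a \<Rightarrow> 'a \<Rightarrow> 'a"
  mneg :: "'a \<Rightarrow> 'a"
  mzero :: 'a

locale mv_algebra =
  fixes A :: "('a, 'm) mv_scheme"
  assumes zero_closed: "mzero A \<in> carrier A"
    and neg_closed: "x \<in> carrier A \<Longrightarrow> mneg A x \<in> carrier A"
    and plus_closed: "\<lbrakk>x \<in> carrier A; y \<in> carrier A\<rbrakk> \<Longrightarrow> mplus A x y \<in> carrier A"
    and plus_assoc: "\<lbrakk>x \<in> carrier A; y \<in> carrier A; z \<in> carrier A\<rbrakk>
          \<Longrightarrow> mplus A (mplus A x y) z = mplus A x (mplus A y z)"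
    and plus_comm: "\<lbrakk>x \<in> carrier A; y \<in> carrier A\<rbrakk> \<Longrightarrow> mplus A x y = mplus A y x"
    and plus_zero: "x \<in> carrier A \<Longrightarrow> mplus A x (mzero A) = x"
    and neg_neg: "x \<in> carrier A \<Longrightarrow> mneg A (mneg A x) = x"
    and plus_one: "x \<in> carrier A \<Longrightarrow> mplus A x (mneg A (mzero A)) = mneg A (mzero A)"
    and luk: "\<lbrakk>x \<in> carrier A; y \<in> carrier A\<rbrakk>
          \<Longrightarrow> mplus A (mneg A (mplus A (mneg A x) y)) y = mplus A (mneg A (mplus A (mneg A y) x)) x"

definition mv_subalgebra :: "'a set \<Rightarrow> ('a, 'm) mv_scheme \<Rightarrow> bool" where
  "mv_subalgebra S A \<longleftrightarrow> S \<subseteq> carrier A \<and> mzero A \<in> S \<and> (\<forall>x\<in>S. mneg A x \<in> S) \<and>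
     (\<forall>x\<in>S. \<forall>y\<in>S. mplus A x y \<in> S)"

definition mv_hom :: "('a, 'm) mv_scheme \<Rightarrow> ('b, 'k) mv_scheme \<Rightarrow> ('a \<Rightarrow> 'b) set" where
  "mv_hom A B = {h \<in> carrier A \<rightarrow> carrier B. h (mzero A) = mzero B \<and>
     (\<forall>x\<in>carrier A. h (mneg A x) = mneg B (h x)) \<and>
     (\<forall>x\<in>carrier A. \<forall>y\<in>carrier A. h (mplus A x y) = mplus B (h x) (h y))}"

definition mv_epi :: "('a, 'm) mv_scheme \<Rightarrow> ('b, 'k) mv_scheme \<Rightarrow> ('a \<Rightarrow> 'b) set" where
  "mv_epi A B = {h \<in> mv_hom A B. h ` carrier A = carrier B}"

definition mv_isomorphic :: "('a, 'm) mv_scheme \<Rightarrow> ('b, 'k) mv_scheme \<Rightarrow> bool" where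
  "mv_isomorphic A B \<longleftrightarrow> (\<exists>h\<in>mv_hom A B. bij_betw h (carrier A) (carrier B))"

inductive_set mv_generate :: "('a, 'm) mv_scheme \<Rightarrow> 'a set \<Rightarrow> 'a set"
  for A :: "('a, 'm) mv_scheme" and G :: "'a set" where
  gen: "x \<in> G \<Longrightarrow> x \<in> mv_generate A G"
| zero: "mzero A \<in> mv_generate A G"
| neg: "x \<in> mv_generate A G \<Longrightarrow> mneg A x \<in> mv_generate A G"
| plus: "\<lbrakk>x \<in> mv_generate A G; y \<in> mv_generate A G\<rbrakk> \<Longrightarrow> mplus A x y \<in> mv_generate A G"

definition n_generated :: "nat \<Rightarrow> ('a, 'm) mv_scheme \<Rightarrow> bool" where
  "n_generated n A \<longleftrightarrow> (\<exists>a \<in> {1..n} \<rightarrow> carrier A. mv_generate A (a ` {1..n}) = carrier A)"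


section \<open>Powers of the standard algebra and semisimplicity\<close>

text \<open>The direct power of the standard MV-algebra $[0,1]$ with index set \<open>X\<close>.\<close>

definition mv_power :: "'x set \<Rightarrow> ('x \<Rightarrow> real) mv" where
  "mv_power X = \<lparr>carrier = X \<rightarrow>\<^sub>E {0..1},
     mplus = (\<lambda>f g. \<lambda>x\<in>X. min 1 (f x + g x)),
     mneg = (\<lambda>f. \<lambda>x\<in>X. 1 - f x),
     mzero = (\<lambda>x\<in>X. 0)\<rparr>"

text \<open>Index sets of powers are taken from the type \<^typ>\<open>'a \<Rightarrow> real\<close>, since an existential
  quantifier cannot range over types.  This loses no generality: by
  \<open>semisimple_mv_algebraI\<close> below, an embedding into a power with index set in an arbitrary
  type suffices.  The one-element algebra is included (empty index set).\<close>

definition semisimple_mv_algebra :: "('a, 'm) mv_scheme \<Rightarrow> bool" where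
  "semisimple_mv_algebra A \<longleftrightarrow> mv_algebra A \<and>
     (\<exists>(X :: ('a \<Rightarrow> real) set) S. mv_subalgebra S (mv_power X) \<and>
        mv_isomorphic A ((mv_power X)\<lparr>carrier := S\<rparr>))"

lemma mv_algebra_power: "mv_algebra (mv_power X)"
proof
qed (auto simp: mv_power_def PiE_iff fun_eq_iff extensional_def min_def)

lemma mv_algebra_subalgebra:
  assumes "mv_algebra A" "mv_subalgebra S A"
  shows "mv_algebra (A\<lparr>carrier := S\<rparr>)"
proof -
  interpret mv_algebra A by fact
  have S: "x \<in> carrier A" if "x \<in> S" for x
    using that assms(2) by (auto simp: mv_subalgebra_def)
  show ?thesis
    using assms(2)
    by unfold_locales
      (simp_all add: mv_subalgebra_def S plus_assoc plus_zero neg_neg plus_one luk,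
       simp add: S plus_comm)
qed

lemma semisimple_mv_algebraI:
  fixes A :: "('a, 'm) mv_scheme" and X :: "'x set"
  assumes A: "mv_algebra A" and e: "e \<in> mv_hom A (mv_power X)" and inj: "inj_on e (carrier A)"
  shows "semisimple_mv_algebra A"
proof -
  interpret mv_algebra A by fact
  define Y :: "('a \<Rightarrow> real) set" where "Y = (\<lambda>x a. e a x) ` X"
  define h where "h = (\<lambda>a. \<lambda>p\<in>Y. p a)"
  have h: "h \<in> mv_hom A (mv_power Y)"
    unfolding mv_hom_def
  proof (intro CollectI conjI ballI)
    show "h \<in> carrier A \<rightarrow> carrier (mv_power Y)"
      using e by (fastforce simp: h_def Y_def mv_hom_def mv_power_def)
    show "h (mzero A) = mzero (mv_power Y)"
      using e by (auto simp: h_def Y_def mv_hom_def mv_power_def restrict_def fun_eq_iff)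
    show "h (mneg A a) = mneg (mv_power Y) (h a)" if "a \<in> carrier A" for a
      using e that by (auto simp: h_def Y_def mv_hom_def mv_power_def restrict_def fun_eq_iff)
    show "h (mplus A a b) = mplus (mv_power Y) (h a) (h b)"
      if "a \<in> carrier A" "b \<in> carrier A" for a b
      using e that by (auto simp: h_def Y_def mv_hom_def mv_power_def restrict_def fun_eq_iff)
  qed
  have inj_h: "inj_on h (carrier A)"
  proof (rule inj_onI)
    fix a b assume ab: "a \<in> carrier A" "b \<in> carrier A" "h a = h b"
    have "e a x = e b x" if "x \<in> X" for x
      using fun_cong[OF ab(3), of "\<lambda>a. e a x"] that by (auto simp: h_def Y_def)
    moreover have "e a \<in> X \<rightarrow>\<^sub>E {0..1}" "e b \<in> X \<rightarrow>\<^sub>E {0..1}"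
      using e ab by (auto simp: mv_hom_def mv_power_def)
    ultimately have "e a = e b" by (metis PiE_ext)
    then show "a = b" using inj ab by (auto dest: inj_onD)
  qed
  let ?S = "h ` carrier A"
  have "mv_subalgebra ?S (mv_power Y)"
    unfolding mv_subalgebra_def
  proof (intro conjI ballI)
    show "?S \<subseteq> carrier (mv_power Y)" using h by (auto simp: mv_hom_def)
    show "mzero (mv_power Y) \<in> ?S"
      using h zero_closed by (auto simp: mv_hom_def intro!: image_eqI[where x = "mzero A"])
  next
    fix x assume "x \<in> ?S"
    then obtain a where "a \<in> carrier A" "x = h a" by blast
    then show "mneg (mv_power Y) x \<in> ?S"
      using h neg_closed[of a] by (auto simp: mv_hom_def intro!: image_eqI[where x = "mneg A a"])
  next
    fix x y assume "x \<in> ?S" "y \<in> ?S"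
    then obtain a b where "a \<in> carrier A" "x = h a" "b \<in> carrier A" "y = h b" by blast
    then show "mplus (mv_power Y) x y \<in> ?S"
      using h plus_closed[of a b]
      by (auto simp: mv_hom_def intro!: image_eqI[where x = "mplus A a b"])
  qed
  moreover have "mv_isomorphic A ((mv_power Y)\<lparr>carrier := ?S\<rparr>)"
    using h inj_h unfolding mv_isomorphic_def
    by (intro bexI[of _ h]) (auto simp: mv_hom_def bij_betw_def)
  ultimately show ?thesis using A unfolding semisimple_mv_algebra_def by blast
qed


section \<open>Projectivity\<close>

text \<open>HOL cannot quantify over all types inside a formula, so the types carrying the test
  algebras \<open>B\<close> and \<open>C\<close> are parameters.  A statement about
  \<open>projective TYPE('b) TYPE('c) A\<close> with \<open>'b\<close>, \<open>'c\<close> free type variables is about all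
  infinite types at once; every algebra has an isomorphic copy whose carrier is a subset of
  some infinite type.\<close>

definition projective :: "'b::infinite itself \<Rightarrow> 'c::infinite itself \<Rightarrow> ('a, 'm) mv_scheme \<Rightarrow> bool" where
  "projective TB TC A \<longleftrightarrow>
     (\<forall>(B :: 'b mv) (C :: 'c mv). semisimple_mv_algebra B \<longrightarrow> semisimple_mv_algebra C \<longrightarrow>
        (\<forall>g \<in> mv_epi C B. \<forall>f \<in> mv_hom A B. \<exists>h \<in> mv_hom A C. \<forall>x\<in>carrier A. g (h x) = f x))"


section \<open>McNaughton functions\<close>

text \<open>The cube $[0,1]^n$: a point is a function on \<open>{1..n}\<close>, extended by \<^const>\<open>undefined\<close>
  outside \<open>{1..n}\<close>.  Continuity refers to the product topology on \<^typ>\<open>nat \<Rightarrow> real\<close>, which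
  induces the Euclidean topology on the cube.\<close>

definition cube :: "nat \<Rightarrow> (nat \<Rightarrow> real) set" where
  "cube n = {1..n} \<rightarrow>\<^sub>E {0..1}"

text \<open>Generators of function algebras are by convention normalised to vanish at the origin.\<close>

definition origin :: "nat \<Rightarrow> nat \<Rightarrow> real" where
  "origin n = (\<lambda>i\<in>{1..n}. 0)"

definition mcnaughton :: "nat \<Rightarrow> ((nat \<Rightarrow> real) \<Rightarrow> real) set" where
  "mcnaughton n = {f \<in> cube n \<rightarrow>\<^sub>E {0..1}. continuous_on (cube n) f \<and>
     (\<exists>P :: (int \<times> (nat \<Rightarrow> int)) set. finite P \<and>
        (\<forall>x\<in>cube n. \<exists>(b, c)\<in>P. f x = of_int b + (\<Sum>i=1..n. of_int (c i) * x i)))}"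

definition free_mv :: "nat \<Rightarrow> ((nat \<Rightarrow> real) \<Rightarrow> real) mv" where
  "free_mv n = (mv_power (cube n))\<lparr>carrier := mcnaughton n\<rparr>"

definition free_gen :: "nat \<Rightarrow> nat \<Rightarrow> (nat \<Rightarrow> real) \<Rightarrow> real" where
  "free_gen n i = (\<lambda>x\<in>cube n. x i)"

definition equalizer :: "nat \<Rightarrow> (nat \<Rightarrow> (nat \<Rightarrow> real) \<Rightarrow> real) \<Rightarrow> (nat \<Rightarrow> real) set" where
  "equalizer n d = {x \<in> cube n. \<forall>i\<in>{1..n}. d i x = free_gen n i x}"

lemma free_gen_mcnaughton:
  assumes i: "i \<in> {1..n}"
  shows "free_gen n i \<in> mcnaughton n"
  unfolding mcnaughton_def
proof (intro CollectI conjI)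
  show "free_gen n i \<in> cube n \<rightarrow>\<^sub>E {0..1}"
    using i by (auto simp: free_gen_def cube_def)
  have "continuous_on (cube n) (\<lambda>x::nat \<Rightarrow> real. x i)"
    by (rule continuous_on_product_then_coordinatewise[OF continuous_on_id])
  then show "continuous_on (cube n) (free_gen n i)"
    by (rule continuous_on_eq) (simp add: free_gen_def)
  have "(\<Sum>j=1..n. of_int (if j = i then 1 else 0) * x j) = x i" for x :: "nat \<Rightarrow> real"
  proof -
    have "(\<Sum>j=1..n. of_int (if j = i then 1 else 0) * x j) = (\<Sum>j=1..n. if j = i then x j else 0)"
      by (rule sum.cong) auto
    then show ?thesis using i by simp
  qed
  then show "\<exists>P :: (int \<times> (nat \<Rightarrow> int)) set. finite P \<and>
      (\<forall>x\<in>cube n. \<exists>(b, c)\<in>P. free_gen n i x = of_int b + (\<Sum>j=1..n. of_int (c j) * x j))"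
    by (intro exI[of _ "{(0, \<lambda>j. if j = i then 1 else 0)}"]) (simp add: free_gen_def)
qed

lemma mcnaughton_subalgebra: "mv_subalgebra (mcnaughton n) (mv_power (cube n))"
  unfolding mv_subalgebra_def
proof (intro conjI ballI)
  let ?ev = "\<lambda>(b::int, c::nat \<Rightarrow> int) x::nat \<Rightarrow> real. of_int b + (\<Sum>i=1..n. of_int (c i) * x i)"
  have ev: "mcnaughton n = {f \<in> cube n \<rightarrow>\<^sub>E {0..1}. continuous_on (cube n) f \<and>
     (\<exists>P. finite P \<and> (\<forall>x\<in>cube n. \<exists>p\<in>P. f x = ?ev p x))}"
    unfolding mcnaughton_def by (auto simp: case_prod_unfold)
  show "mcnaughton n \<subseteq> carrier (mv_power (cube n))"
    by (auto simp: mcnaughton_def mv_power_def)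
  show "mzero (mv_power (cube n)) \<in> mcnaughton n"
    unfolding ev by (auto simp: mv_power_def intro!: exI[of _ "{(0, \<lambda>_. 0)}"])
  fix f assume f: "f \<in> mcnaughton n"
  then obtain P where P: "finite P" "\<And>x. x \<in> cube n \<Longrightarrow> \<exists>p\<in>P. f x = ?ev p x"
    unfolding ev by blast
  have fr: "0 \<le> f x" "f x \<le> 1" if "x \<in> cube n" for x
    using f that by (auto simp: ev PiE_def Pi_def)
  have cf: "continuous_on (cube n) f" using f by (auto simp: ev)
  {
    let ?N = "\<lambda>p. (1 - fst p, \<lambda>i. - snd p i) :: int \<times> (nat \<Rightarrow> int)"
    have "?ev (?N p) x = 1 - ?ev p x" for p x
      by (simp add: case_prod_unfold sum_negf)
    then have "\<forall>x\<in>cube n. \<exists>p\<in>?N ` P. 1 - f x = ?ev p x"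
      using P(2) by (metis (no_types, lifting) imageI)
    moreover have "continuous_on (cube n) (\<lambda>x\<in>cube n. 1 - f x)"
      by (rule continuous_on_eq[of _ "\<lambda>x. 1 - f x"]) (intro continuous_on_diff continuous_on_const cf, simp)
    ultimately show "mneg (mv_power (cube n)) f \<in> mcnaughton n"
      unfolding ev using P(1) fr by (auto simp: mv_power_def intro!: exI[of _ "?N ` P"])
  }
  fix g assume g: "g \<in> mcnaughton n"
  then obtain Q where Q: "finite Q" "\<And>x. x \<in> cube n \<Longrightarrow> \<exists>p\<in>Q. g x = ?ev p x"
    unfolding ev by blast
  have gr: "0 \<le> g x" "g x \<le> 1" if "x \<in> cube n" for x
    using g that by (auto simp: ev PiE_def Pi_def)
  have cg: "continuous_on (cube n) g" using g by (auto simp: ev)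
  let ?S = "\<lambda>(p, q). (fst p + fst q, \<lambda>i. snd p i + snd q i) :: int \<times> (nat \<Rightarrow> int)"
  let ?R = "insert (1, \<lambda>_. 0) (?S ` (P \<times> Q))"
  have S: "?ev (?S (p, q)) x = ?ev p x + ?ev q x" for p q x
    by (simp add: case_prod_unfold sum.distrib algebra_simps)
  have "\<forall>x\<in>cube n. \<exists>p\<in>?R. min 1 (f x + g x) = ?ev p x"
  proof
    fix x assume x: "x \<in> cube n"
    obtain p q where pq: "p \<in> P" "q \<in> Q" "f x = ?ev p x" "g x = ?ev q x"
      using P(2)[OF x] Q(2)[OF x] by blast
    show "\<exists>p\<in>?R. min 1 (f x + g x) = ?ev p x"
    proof (cases "f x + g x \<le> 1")
      case True
      then have "min 1 (f x + g x) = ?ev (?S (p, q)) x" by (simp only: S pq min_def) simp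
      moreover have "?S (p, q) \<in> ?R" using pq by blast
      ultimately show ?thesis by blast
    next
      case False
      then have "min 1 (f x + g x) = ?ev (1, \<lambda>_. 0) x" by simp
      then show ?thesis by blast
    qed
  qed
  moreover have "continuous_on (cube n) (\<lambda>x\<in>cube n. min 1 (f x + g x))"
    by (rule continuous_on_eq[of _ "\<lambda>x. min 1 (f x + g x)"])
      (intro continuous_on_min continuous_on_add continuous_on_const cf cg, simp)
  moreover have "finite ?R" using P(1) Q(1) by blast
  moreover have "mplus (mv_power (cube n)) f g = (\<lambda>x\<in>cube n. min 1 (f x + g x))"
    by (simp add: mv_power_def)
  moreover have "(\<lambda>x\<in>cube n. min 1 (f x + g x)) \<in> cube n \<rightarrow>\<^sub>E {0..1}" using fr gr by auto
  ultimately show "mplus (mv_power (cube n)) f g \<in> mcnaughton n"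
    unfolding ev by (smt (verit, best) mem_Collect_eq restrict_apply')
qed

end

theory Submission
  imports Defs
begin

text \<open>By McNaughton's theorem the coordinate projections generate \<open>Free\<^sub>n\<close>, so \<open>Free\<^sub>n\<close> has the
  universal property for semisimple algebras, and the projective \<open>n\<close>-generated algebras are the
  retracts of \<open>Free\<^sub>n\<close>.  An endomorphism \<open>\<phi>\<close> of \<open>Free\<^sub>n\<close> is \<open>f \<mapsto> f \<circ> d\<close> with
  \<open>d = (\<phi> g\<^sub>1, \<dots>, \<phi> g\<^sub>n)\<close>; its equalizer is the set of fixed points of \<open>d\<close>, and the condition on
  \<open>K\<close> says that \<open>d\<close>, equivalently \<open>\<phi>\<close>, is idempotent.

  McNaughton's theorem is proved without triangulations: a continuous piecewise affine function
  is a maximum of minima of its pieces, and truncated integral affine functions are obtained from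
  the projections by the Rose--Rosser identity.  Countability of \<open>n\<close>-generated algebras
  provides the copies in arbitrary infinite types on which projectivity is tested.\<close>

section \<open>McNaughton's theorem\<close>

text \<open>If no piece worked, let \<open>\<tau>\<close> be the last time at which some piece
  starting at or below \<open>f 0\<close> is still at or above \<open>f\<close>; then
  \<open>\<tau> < 1\<close>. Right after \<open>\<tau>\<close> the graph would follow pieces lying
  strictly above \<open>f \<tau>\<close> at \<open>\<tau>\<close>, a jump that continuity
  forbids.\<close>

lemma affine_pieces_comparison:
  fixes f :: "real \<Rightarrow> real" and a s :: "'p \<Rightarrow> real"
  assumes fin: "finite P" and cont: "continuous_on {0..1} f"
    and pieces: "\<And>t. t \<in> {0..1} \<Longrightarrow> \<exists>p\<in>P. f t = a p + t * s p"
  shows "\<exists>p\<in>P. a p \<le> f 0 \<and> f 1 \<le> a p + s p"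
proof (rule ccontr)
  assume neg: "\<not> ?thesis"
  define D where "D = (\<Union>p\<in>{p\<in>P. a p \<le> f 0}. {t\<in>{0..1}. f t \<le> a p + t * s p})"
  have "closed D"
    unfolding D_def using fin
    by (intro closed_UN ballI continuous_on_closed_Collect_le cont continuous_intros) auto
  have "0 \<in> D" using pieces[of 0] by (force simp: D_def)
  have bdd: "bdd_above D" by (rule bdd_aboveI[of _ 1]) (auto simp: D_def)
  define \<tau> where "\<tau> = Sup D"
  have "\<tau> \<in> D"
    using closed_contains_Sup[of D] \<open>closed D\<close> \<open>0 \<in> D\<close> bdd by (auto simp: \<tau>_def)
  then obtain q where q: "a q \<le> f 0" "q \<in> P" and f\<tau>: "f \<tau> \<le> a q + \<tau> * s q"
    and \<tau>: "0 \<le> \<tau>" "\<tau> \<le> 1"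
    by (auto simp: D_def)
  \<comment> \<open>At \<open>\<tau> = 1\<close> the piece \<open>q\<close> would satisfy the
    claim.\<close>
  have "\<tau> \<noteq> 1" using f\<tau> q neg by auto
  then have "\<tau> < 1" using \<tau> by simp
  \<comment> \<open>\<open>E\<close> collects the times at which \<open>f\<close> is on or above a
    piece exceeding \<open>f \<tau>\<close> at \<open>\<tau>\<close>. It cannot contain
    \<open>\<tau>\<close>, yet it is closed and contains the whole interval between
    \<open>\<tau>\<close> and 1.\<close>
  define E where "E = (\<Union>p\<in>{p\<in>P. f \<tau> < a p + \<tau> * s p}. {t\<in>{0..1}. a p + t * s p \<le> f t})"
  have "closed E"
    unfolding E_def using fin
    by (intro closed_UN ballI continuous_on_closed_Collect_le cont continuous_intros) auto
  have "{\<tau><..<1} \<subseteq> E"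
  proof
    fix t assume t: "t \<in> {\<tau><..<1}"
    then have t01: "t \<in> {0..1}" using \<tau> by auto
    \<comment> \<open>Nothing beyond \<open>Sup D\<close> lies in \<open>D\<close>. Hence the active
      piece \<open>p\<close> starts above \<open>f 0\<close>, and \<open>q\<close> has dropped below
      \<open>f t\<close>, which is the value of \<open>p\<close> at \<open>t\<close>.\<close>
    have "t \<notin> D" using t bdd by (auto simp: \<tau>_def dest: cSup_upper)
    obtain p where p: "p \<in> P" "f t = a p + t * s p" using pieces[OF t01] by blast
    have a: "f 0 < a p" using \<open>t \<notin> D\<close> p t01 by (force simp: D_def)
    have b: "a q + t * s q < a p + t * s p" using \<open>t \<notin> D\<close> p t01 q by (force simp: D_def)
    text \<open>The pieces \<open>p\<close> and \<open>q\<close> compare strictly at \<open>0\<close> and at \<open>t\<close>, hence in between.\<close>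
    have "0 < t * ((a p + \<tau> * s p) - (a q + \<tau> * s q))"
    proof -
      have "t * ((a p + \<tau> * s p) - (a q + \<tau> * s q)) =
          (t - \<tau>) * (a p - a q) + \<tau> * ((a p + t * s p) - (a q + t * s q))"
        by (simp add: algebra_simps)
      moreover have "0 < (t - \<tau>) * (a p - a q)" using t a q by (intro mult_pos_pos) auto
      moreover have "0 \<le> \<tau> * ((a p + t * s p) - (a q + t * s q))"
        using \<tau> b by (intro mult_nonneg_nonneg) auto
      ultimately show ?thesis by linarith
    qed
    then have "f \<tau> < a p + \<tau> * s p" using f\<tau> t \<tau> by (simp add: zero_less_mult_iff)
    then show "t \<in> E" using p t01 by (auto simp: E_def)
  qed
  then have "closure {\<tau><..<1} \<subseteq> E" using \<open>closed E\<close> by (rule closure_minimal)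
  then have "\<tau> \<in> E" using \<open>\<tau> < 1\<close> by (auto simp: closure_greaterThanLessThan)
  then show False by (auto simp: E_def)
qed

section \<open>Closure properties of the functions generated by the projections\<close>

abbreviation affine_value :: "nat \<Rightarrow> int \<times> (nat \<Rightarrow> int) \<Rightarrow> (nat \<Rightarrow> real) \<Rightarrow> real" where
  "affine_value n p x \<equiv> of_int (fst p) + (\<Sum>i=1..n. of_int (snd p i) * x i)"

definition trunc :: "real \<Rightarrow> real" where
  "trunc t = max 0 (min 1 t)"

lemma free_mv_simps [simp]:
  "carrier (free_mv n) = mcnaughton n"
  "mplus (free_mv n) = (\<lambda>f g. \<lambda>x\<in>cube n. min 1 (f x + g x))"
  "mneg (free_mv n) = (\<lambda>f. \<lambda>x\<in>cube n. 1 - f x)"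
  "mzero (free_mv n) = (\<lambda>x\<in>cube n. 0)"
  by (simp_all add: free_mv_def mv_power_def)

lemma mv_algebra_free: "mv_algebra (free_mv n)"
  unfolding free_mv_def by (intro mv_algebra_subalgebra mv_algebra_power mcnaughton_subalgebra)

lemma free_gens_closed: "free_gen n ` {1..n} \<subseteq> carrier (free_mv n)"
  using free_gen_mcnaughton by (intro image_subsetI) simp

lemma mv_generate_closed:
  assumes "mv_algebra A" "G \<subseteq> carrier A" "x \<in> mv_generate A G"
  shows "x \<in> carrier A"
proof -
  interpret mv_algebra A by fact
  from assms(3) show ?thesis
    by induction (use assms(2) zero_closed neg_closed plus_closed in auto)
qed

lemma mcnaughton_range: "f \<in> mcnaughton n \<Longrightarrow> x \<in> cube n \<Longrightarrow> 0 \<le> f x \<and> f x \<le> 1"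
  by (auto simp: mcnaughton_def PiE_def Pi_def)

lemma mcnaughton_restrict: "f \<in> mcnaughton n \<Longrightarrow> restrict f (cube n) = f"
  by (auto simp: mcnaughton_def)

text \<open>Restriction to the cube is built in, so that membership can be stated for plain terms in
  \<open>x\<close> rather than for extensional functions.\<close>

definition mv_representable :: "nat \<Rightarrow> ((nat \<Rightarrow> real) \<Rightarrow> real) \<Rightarrow> bool" where
  "mv_representable n F \<longleftrightarrow>
     restrict F (cube n) \<in> mv_generate (free_mv n) (free_gen n ` {1..n})"

context
  fixes n :: nat
begin

lemma representable_cong:
  assumes "mv_representable n F" "\<And>x. x \<in> cube n \<Longrightarrow> F x = F' x"
  shows "mv_representable n F'"
proof -
  have "restrict F (cube n) = restrict F' (cube n)" using assms(2) by auto
  then show ?thesis using assms(1) by (simp add: mv_representable_def)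
qed

lemma representable_range:
  assumes "mv_representable n F" "x \<in> cube n"
  shows "0 \<le> F x" "F x \<le> 1"
proof -
  have "restrict F (cube n) \<in> mcnaughton n"
    using mv_generate_closed[OF mv_algebra_free free_gens_closed]
      assms(1) by (simp add: mv_representable_def)
  from mcnaughton_range[OF this assms(2)] assms(2) show "0 \<le> F x" "F x \<le> 1" by auto
qed

lemma representable_zero: "mv_representable n (\<lambda>x. 0)"
  using mv_generate.zero[of "free_mv n"] by (simp add: mv_representable_def)

lemma representable_gen: "i \<in> {1..n} \<Longrightarrow> mv_representable n (\<lambda>x. x i)"
  unfolding mv_representable_def
  by (rule mv_generate.gen) (auto simp: free_gen_def)

lemma representable_neg:
  assumes "mv_representable n F"
  shows "mv_representable n (\<lambda>x. 1 - F x)"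
proof -
  have "mneg (free_mv n) (restrict F (cube n)) = (\<lambda>x\<in>cube n. 1 - F x)" by auto
  then show ?thesis using mv_generate.neg[OF assms[unfolded mv_representable_def]]
    by (simp only: mv_representable_def)
qed

lemma representable_plus:
  assumes "mv_representable n F" "mv_representable n G"
  shows "mv_representable n (\<lambda>x. min 1 (F x + G x))"
proof -
  have "mplus (free_mv n) (restrict F (cube n)) (restrict G (cube n)) = (\<lambda>x\<in>cube n. min 1 (F x + G x))"
    by auto
  then show ?thesis
    using mv_generate.plus[OF assms[unfolded mv_representable_def]]
    by (simp only: mv_representable_def)
qed

text \<open>The Lukasiewicz term \<open>\<not>(\<not>F \<oplus> G) \<oplus> G\<close> computes the
  maximum of two functions with values in [0,1].\<close>

lemma representable_max:
  assumes F: "mv_representable n F" and G: "mv_representable n G"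
  shows "mv_representable n (\<lambda>x. max (F x) (G x))"
  by (rule representable_cong[OF representable_plus[OF
        representable_neg[OF representable_plus[OF representable_neg[OF F] G]] G]])
    (use representable_range[OF F] representable_range[OF G] in \<open>force simp: max_def min_def\<close>)

lemma representable_min:
  assumes F: "mv_representable n F" and G: "mv_representable n G"
  shows "mv_representable n (\<lambda>x. min (F x) (G x))"
  by (rule representable_cong[OF representable_neg[OF
        representable_max[OF representable_neg[OF F] representable_neg[OF G]]]]) auto

lemma representable_Min:
  assumes "finite S" "S \<noteq> {}" "\<And>p. p \<in> S \<Longrightarrow> mv_representable n (F p)"
  shows "mv_representable n (\<lambda>x. Min ((\<lambda>p. F p x) ` S))"
  using assms by (induction S rule: finite_ne_induct) (auto intro: representable_min)

lemma representable_Max: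
  assumes "finite S" "S \<noteq> {}" "\<And>p. p \<in> S \<Longrightarrow> mv_representable n (F p)"
  shows "mv_representable n (\<lambda>x. Max ((\<lambda>p. F p x) ` S))"
  using assms by (induction S rule: finite_ne_induct) (auto intro: representable_max)

text \<open>The Rose--Rosser identity: \<open>trunc (F + x\<^sub>i) = (trunc F \<oplus> x\<^sub>i) \<odot> trunc (F + 1)\<close>.\<close>

lemma representable_trunc_add:
  assumes F: "mv_representable n (\<lambda>x. trunc (F x))"
    and F1: "mv_representable n (\<lambda>x. trunc (F x + 1))" and i: "i \<in> {1..n}"
  shows "mv_representable n (\<lambda>x. trunc (F x + x i))"
proof (rule representable_cong[OF representable_neg[OF representable_plus[OF
        representable_neg[OF representable_plus[OF F representable_gen[OF i]]]
        representable_neg[OF F1]]]])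
  fix x assume "x \<in> cube n"
  then have "0 \<le> x i" "x i \<le> 1" using i by (auto simp: cube_def)
  then show "1 - min 1 (1 - min 1 (trunc (F x) + x i) + (1 - trunc (F x + 1))) = trunc (F x + x i)"
    by (auto simp: trunc_def max_def min_def)
qed

section \<open>Truncated integral affine functions\<close>

lemma trunc_one_minus: "trunc (1 - t) = 1 - trunc t"
  by (auto simp: trunc_def max_def min_def)

text \<open>Induction on the sum of the absolute values of the coefficients. A positive coefficient
  is lowered by one through the Rose--Rosser identity, which calls on the smaller form with both
  \<open>b\<close> and \<open>b + 1\<close>; hence \<open>b\<close> is arbitrary. A negative
  coefficient becomes positive on replacing the form by 1 minus itself, and a constant form
  truncates to 0 or 1.\<close>

lemma representable_trunc_affine: "mv_representable n (\<lambda>x. trunc (affine_value n (b, c) x))"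
proof (induction "\<Sum>i=1..n. nat \<bar>c i\<bar>" arbitrary: b c rule: less_induct)
  case less
  \<comment> \<open>Stated for every coefficient vector of the same size, not just for
    \<open>c\<close>, so that it also covers the negated vector.\<close>
  have *: "mv_representable n (\<lambda>x. trunc (affine_value n (b', c') x))"
    if le: "(\<Sum>i=1..n. nat \<bar>c' i\<bar>) = (\<Sum>i=1..n. nat \<bar>c i\<bar>)" and i: "i \<in> {1..n}" and pos: "c' i > 0"
    for b' c' i
  proof -
    let ?c = "c'(i := c' i - 1)"
    have "(\<Sum>j=1..n. nat \<bar>?c j\<bar>) < (\<Sum>j=1..n. nat \<bar>c' j\<bar>)"
      using i pos by (intro sum_strict_mono_ex1) auto
    then have "(\<Sum>j=1..n. nat \<bar>?c j\<bar>) < (\<Sum>j=1..n. nat \<bar>c j\<bar>)" by (simp only: le)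
    then have IH: "mv_representable n (\<lambda>x. trunc (affine_value n (b'', ?c) x))" for b''
      by (rule less)
    have "affine_value n (b', c') x = affine_value n (b', ?c) x + x i" for x
    proof -
      have "(\<Sum>j=1..n. of_int (c' j) * x j) =
          (\<Sum>j=1..n. of_int (?c j) * x j + (if j = i then x j else 0))"
        by (intro sum.cong) (auto simp: algebra_simps)
      also have "\<dots> = (\<Sum>j=1..n. of_int (?c j) * x j) + x i"
        using i by (simp add: sum.distrib)
      finally show ?thesis by simp
    qed
    moreover have "mv_representable n (\<lambda>x. trunc (affine_value n (b', ?c) x + x i))"
      by (rule representable_trunc_add[OF IH _ i], rule representable_cong[OF IH[of "b' + 1"]])
        (simp add: algebra_simps)
    ultimately show ?thesis by (simp only:)
  qed
  consider (zero) "\<forall>i\<in>{1..n}. c i = 0" | (pos) i where "i \<in> {1..n}" "c i > 0"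
    | (neg) i where "i \<in> {1..n}" "c i < 0"
    by (meson linorder_neqE)
  then show ?case
  proof cases
    case zero
    show ?thesis
    proof (cases "b \<ge> 1")
      case True
      then show ?thesis
        using zero by (intro representable_cong[OF representable_neg[OF representable_zero]])
          (auto simp: trunc_def)
    next
      case False
      then show ?thesis
        using zero by (intro representable_cong[OF representable_zero])
          (auto simp: trunc_def max_def min_def)
    qed
  next
    case (pos i)
    then show ?thesis by (intro *) auto
  next
    case (neg i)
    have "mv_representable n (\<lambda>x. trunc (affine_value n (1 - b, \<lambda>i. - c i) x))"
      using neg by (intro *) auto
    then show ?thesis
    proof (rule representable_cong[OF representable_neg])
      fix x :: "nat \<Rightarrow> real"
      have "affine_value n (1 - b, \<lambda>i. - c i) x = 1 - affine_value n (b, c) x"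
        by (simp add: sum_negf)
      then show "1 - trunc (affine_value n (1 - b, \<lambda>i. - c i) x) = trunc (affine_value n (b, c) x)"
        by (simp only: trunc_one_minus)
    qed
  qed
qed

text \<open>Along the segment from \<open>x\<close> to \<open>y\<close> every affine form is affine
  in the parameter, so the comparison in one variable applies.\<close>

lemma continuous_pieces_comparison:
  assumes fin: "finite P" and cont: "continuous_on (cube n) f"
    and pieces: "\<And>x. x \<in> cube n \<Longrightarrow> \<exists>p\<in>P. f x = affine_value n p x"
    and x: "x \<in> cube n" and y: "y \<in> cube n"
  shows "\<exists>p\<in>P. affine_value n p x \<le> f x \<and> f y \<le> affine_value n p y"
proof -
  \<comment> \<open>Outside \<open>{1..n}\<close> the value must be \<open>undefined\<close>, since
    points of the cube are extensional.\<close>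
  define z where "z t = (\<lambda>i. if i \<in> {1..n} then x i + t * (y i - x i) else undefined)" for t :: real
  have z: "z t \<in> cube n" if "t \<in> {0..1}" for t
  proof -
    have "x i + t * (y i - x i) \<in> {0..1}" if "i \<in> {1..n}" for i
    proof -
      have "x i \<in> {0..1}" "y i \<in> {0..1}" using x y that by (auto simp: cube_def)
      then have "(1 - t) *\<^sub>R x i + t *\<^sub>R y i \<in> {0..1}"
        using \<open>t \<in> {0..1}\<close> by (intro convexD_alt) auto
      then show ?thesis by (simp add: algebra_simps)
    qed
    then show ?thesis by (auto simp: z_def cube_def PiE_iff extensional_def)
  qed
  have z01: "z 0 = x" "z 1 = y" using x y by (auto simp: z_def cube_def PiE_iff extensional_def)
  have "continuous_on {0..1} z"
  proof (rule continuous_on_coordinatewise_then_product)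
    fix i show "continuous_on {0..1} (\<lambda>t. z t i)"
      by (cases "i \<in> {1..n}") (auto simp: z_def intro!: continuous_intros)
  qed
  then have cf: "continuous_on {0..1} (\<lambda>t. f (z t))"
    by (rule continuous_on_compose2[OF cont]) (use z in auto)
  have av: "affine_value n p (z t) =
      affine_value n p x + t * (affine_value n p y - affine_value n p x)" for p t
    by (simp add: z_def sum.distrib sum_subtractf sum_distrib_left algebra_simps)
  have "\<exists>p\<in>P. affine_value n p x \<le> f (z 0) \<and>
      f (z 1) \<le> affine_value n p x + (affine_value n p y - affine_value n p x)"
    by (rule affine_pieces_comparison[OF fin cf]) (use pieces[OF z] av in metis)
  then show ?thesis by (simp add: z01)
qed

text \<open>With \<open>S\<^sub>y\<close> the set of pieces that lie above \<open>f\<close> at \<open>y\<close>, the comparison lemma says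
  \<open>Min S\<^sub>y \<le> f\<close> everywhere, with equality at \<open>y\<close>; hence \<open>f\<close> is the maximum of these minima.\<close>

lemma representable_mcnaughton:
  assumes f: "f \<in> mcnaughton n"
  shows "mv_representable n f"
proof -
  obtain P where fin: "finite P" and pieces: "\<And>x. x \<in> cube n \<Longrightarrow> \<exists>p\<in>P. f x = affine_value n p x"
    using f by (auto simp: mcnaughton_def case_prod_unfold)
  have cont: "continuous_on (cube n) f" using f by (simp add: mcnaughton_def)
  define S where "S y = {p\<in>P. f y \<le> affine_value n p y}" for y
  have S_fin: "finite (S y)" for y using fin by (simp add: S_def)
  have S_ne: "S y \<noteq> {}" if "y \<in> cube n" for y using pieces[OF that] by (force simp: S_def)
  \<comment> \<open>Truncation fixes the values of \<open>f\<close> and is monotone, so the pieces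
    may be truncated without disturbing their comparison with \<open>f\<close>.\<close>
  have trf: "trunc (f x) = f x" if "x \<in> cube n" for x
    using mcnaughton_range[OF f that] by (simp add: trunc_def)
  have mono: "trunc s \<le> trunc t" if "s \<le> t" for s t using that by (auto simp: trunc_def)
  define m where "m Q x = Min ((\<lambda>p. trunc (affine_value n p x)) ` Q)" for Q x
  have m_le: "m (S y) x \<le> f x" if xy: "x \<in> cube n" "y \<in> cube n" for x y
  proof -
    obtain p where p: "p \<in> S y" "affine_value n p x \<le> f x"
      using continuous_pieces_comparison[OF fin cont pieces xy] by (auto simp: S_def)
    have "m (S y) x \<le> trunc (affine_value n p x)"
      using S_fin p unfolding m_def by (intro Min_le) auto
    also have "\<dots> \<le> f x" using mono[OF p(2)] trf[OF xy(1)] by simp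
    finally show ?thesis .
  qed
  have m_ge: "f x \<le> m (S x) x" if x: "x \<in> cube n" for x
    unfolding m_def using S_fin[of x] S_ne[OF x] trf[OF x] mono[of "f x"]
    by (subst Min_ge_iff) (auto simp: S_def)
  \<comment> \<open>Although \<open>y\<close> ranges over the whole cube, only finitely many sets
    \<open>S y\<close> occur, all being subsets of \<open>P\<close>; so the maximum is
    finite.\<close>
  have finS: "finite (S ` cube n)"
    by (rule finite_subset[of _ "Pow P"]) (use fin in \<open>auto simp: S_def\<close>)
  \<comment> \<open>Serves to show that the family of minima is nonempty.\<close>
  have o: "origin n \<in> cube n" by (auto simp: origin_def cube_def)
  have rep: "mv_representable n (m Q)" if "Q \<in> S ` cube n" for Q
    unfolding m_def
  proof (rule representable_Min)
    show "mv_representable n (\<lambda>x. trunc (affine_value n p x))" for p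
      using representable_trunc_affine[of "fst p" "snd p"] by simp
  qed (use that S_fin S_ne in auto)
  have "mv_representable n (\<lambda>x. Max ((\<lambda>Q. m Q x) ` S ` cube n))"
    by (rule representable_Max[OF finS _ rep]) (use o in auto)
  then show ?thesis
  proof (rule representable_cong)
    fix x assume x: "x \<in> cube n"
    show "Max ((\<lambda>Q. m Q x) ` S ` cube n) = f x"
    proof (rule antisym)
      show "Max ((\<lambda>Q. m Q x) ` S ` cube n) \<le> f x"
        using finS x m_le by (subst Max_le_iff) auto
      show "f x \<le> Max ((\<lambda>Q. m Q x) ` S ` cube n)"
        using finS x m_ge[OF x] by (subst Max_ge_iff) auto
    qed
  qed
qed

end

theorem mv_generate_free: "mv_generate (free_mv n) (free_gen n ` {1..n}) = mcnaughton n"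
proof
  show "mv_generate (free_mv n) (free_gen n ` {1..n}) \<subseteq> mcnaughton n"
    using mv_generate_closed[OF mv_algebra_free free_gens_closed] by auto
  show "mcnaughton n \<subseteq> mv_generate (free_mv n) (free_gen n ` {1..n})"
  proof
    fix f assume f: "f \<in> mcnaughton n"
    show "f \<in> mv_generate (free_mv n) (free_gen n ` {1..n})"
      using representable_mcnaughton[OF f] mcnaughton_restrict[OF f] by (simp add: mv_representable_def)
  qed
qed


section \<open>Homomorphisms\<close>

lemma mv_hom_closed: "h \<in> mv_hom A B \<Longrightarrow> x \<in> carrier A \<Longrightarrow> h x \<in> carrier B"
  by (auto simp: mv_hom_def)

lemma mv_hom_compose:
  "f \<in> mv_hom A B \<Longrightarrow> g \<in> mv_hom B C \<Longrightarrow> g \<circ> f \<in> mv_hom A C"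
  by (auto simp: mv_hom_def Pi_def)

lemma mv_hom_image_generate:
  assumes "mv_algebra A" "h \<in> mv_hom A B" "G \<subseteq> carrier A"
  shows "h ` mv_generate A G = mv_generate B (h ` G)"
proof
  note closed = mv_generate_closed[OF assms(1,3)]
  have "h x \<in> mv_generate B (h ` G)" if "x \<in> mv_generate A G" for x
    using that
  proof induction
    case zero
    then show ?case using assms(2) mv_generate.zero[of B] by (simp add: mv_hom_def)
  next
    case (neg x)
    then show ?case using assms(2) closed mv_generate.neg[of "h x"] by (simp add: mv_hom_def)
  next
    case (plus x y)
    then show ?case using assms(2) closed mv_generate.plus[of "h x" B _ "h y"]
      by (simp add: mv_hom_def)
  qed (auto intro: mv_generate.gen)
  then show "h ` mv_generate A G \<subseteq> mv_generate B (h ` G)" by blast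
  have "y \<in> h ` mv_generate A G" if "y \<in> mv_generate B (h ` G)" for y
    using that
  proof induction
    case (gen y)
    then show ?case by (auto intro: mv_generate.gen)
  next
    case zero
    then show ?case using assms(2) mv_generate.zero[of A]
      by (intro image_eqI[of _ _ "mzero A"]) (auto simp: mv_hom_def)
  next
    case (neg y)
    then obtain x where "x \<in> mv_generate A G" "y = h x" by blast
    then show ?case using assms(2) closed
      by (intro image_eqI[of _ _ "mneg A x"]) (auto simp: mv_hom_def intro: mv_generate.neg)
  next
    case (plus y y')
    then obtain x x' where "x \<in> mv_generate A G" "y = h x" "x' \<in> mv_generate A G" "y' = h x'"
      by blast
    then show ?case using assms(2) closed
      by (intro image_eqI[of _ _ "mplus A x x'"]) (auto simp: mv_hom_def intro: mv_generate.plus)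
  qed
  then show "mv_generate B (h ` G) \<subseteq> h ` mv_generate A G" by blast
qed

lemma mv_hom_eq_on_generate:
  assumes "mv_algebra A" "h \<in> mv_hom A B" "k \<in> mv_hom A B" "G \<subseteq> carrier A"
    and eq: "\<And>x. x \<in> G \<Longrightarrow> h x = k x" and "x \<in> mv_generate A G"
  shows "h x = k x"
  using assms(6)
proof induction
  case zero
  then show ?case using assms(2,3) by (simp add: mv_hom_def)
next
  case (neg x)
  then show ?case using assms(2,3) mv_generate_closed[OF assms(1,4)] by (simp add: mv_hom_def)
next
  case (plus x y)
  then show ?case using assms(2,3) mv_generate_closed[OF assms(1,4)] by (simp add: mv_hom_def)
qed (rule eq)

text \<open>As \<open>e\<close> is injective, an element of \<open>A\<close> is determined by its
  image under \<open>e\<close>; so a homomorphism \<open>k\<close> with range inside that of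
  \<open>e\<close> factors through \<open>e\<close>.\<close>

lemma mv_hom_lift:
  assumes A: "mv_algebra A" and e: "e \<in> mv_hom A P" and inj: "inj_on e (carrier A)"
    and k: "k \<in> mv_hom F P" and sub: "k ` carrier F \<subseteq> e ` carrier A" and F: "mv_algebra F"
  shows "(\<lambda>x. inv_into (carrier A) e (k x)) \<in> mv_hom F A"
proof -
  interpret A: mv_algebra A by fact
  interpret F: mv_algebra F by fact
  let ?h = "\<lambda>x. inv_into (carrier A) e (k x)"
  have eq: "?h x = a" if "k x = e a" "a \<in> carrier A" for x a
    using that inj by simp
  have h: "?h x \<in> carrier A" "e (?h x) = k x" if "x \<in> carrier F" for x
  proof -
    have "k x \<in> e ` carrier A" using that sub by blast
    then show "?h x \<in> carrier A" "e (?h x) = k x" by (auto intro: inv_into_into f_inv_into_f)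
  qed
  show ?thesis
    unfolding mv_hom_def
  proof (intro CollectI conjI ballI)
    show "?h \<in> carrier F \<rightarrow> carrier A" using h by auto
    show "?h (mzero F) = mzero A"
      using e k by (intro eq A.zero_closed) (simp add: mv_hom_def)
  next
    fix x assume x: "x \<in> carrier F"
    show "?h (mneg F x) = mneg A (?h x)"
      using e k x h by (intro eq A.neg_closed) (simp_all add: mv_hom_def)
    fix y assume y: "y \<in> carrier F"
    show "?h (mplus F x y) = mplus A (?h x) (?h y)"
      using e k x y h by (intro eq A.plus_closed) (simp_all add: mv_hom_def)
  qed
qed

lemma mv_subalgebra_hom_image:
  assumes A: "mv_algebra A" and h: "h \<in> mv_hom A B"
  shows "mv_subalgebra (h ` carrier A) B"
proof -
  interpret mv_algebra A by fact
  show ?thesis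
    unfolding mv_subalgebra_def
  proof (intro conjI ballI)
    show "h ` carrier A \<subseteq> carrier B" using h by (auto simp: mv_hom_def)
    show "mzero B \<in> h ` carrier A"
      using h zero_closed by (auto simp: mv_hom_def intro!: image_eqI[of _ _ "mzero A"])
  next
    fix x assume "x \<in> h ` carrier A"
    then obtain a where a: "a \<in> carrier A" "x = h a" by blast
    then show "mneg B x \<in> h ` carrier A"
      using h neg_closed[of a] by (auto simp: mv_hom_def intro!: image_eqI[of _ _ "mneg A a"])
    fix y assume "y \<in> h ` carrier A"
    then obtain b where "b \<in> carrier A" "y = h b" by blast
    then show "mplus B x y \<in> h ` carrier A"
      using h a plus_closed[of a b]
      by (auto simp: mv_hom_def intro!: image_eqI[of _ _ "mplus A a b"])
  qed
qed

lemma semisimple_imp_mv_algebra: "semisimple_mv_algebra A \<Longrightarrow> mv_algebra A"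
  by (simp add: semisimple_mv_algebra_def)

lemma semisimple_embedding:
  fixes A :: "('a, 'm) mv_scheme"
  assumes "semisimple_mv_algebra A"
  obtains X :: "('a \<Rightarrow> real) set" and e
  where "e \<in> mv_hom A (mv_power X)" "inj_on e (carrier A)"
proof -
  obtain X :: "('a \<Rightarrow> real) set" and S e
    where S: "mv_subalgebra S (mv_power X)" and e: "e \<in> mv_hom A ((mv_power X)\<lparr>carrier := S\<rparr>)"
      and "bij_betw e (carrier A) S"
    using assms by (auto simp: semisimple_mv_algebra_def mv_isomorphic_def)
  moreover have "e \<in> mv_hom A (mv_power X)"
    using S e by (auto simp: mv_hom_def mv_subalgebra_def)
  ultimately show ?thesis using that by (auto simp: bij_betw_def)
qed


section \<open>The free algebra\<close>

lemma free_gen_apply: "x \<in> cube n \<Longrightarrow> free_gen n i x = x i"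
  by (simp add: free_gen_def)

lemma mv_hom_free_power:
  assumes "h \<in> mv_hom F (free_mv n)"
  shows "h \<in> mv_hom F (mv_power (cube n))"
proof -
  have ops: "mplus (free_mv n) = mplus (mv_power (cube n))"
    "mneg (free_mv n) = mneg (mv_power (cube n))" "mzero (free_mv n) = mzero (mv_power (cube n))"
    by (simp_all add: free_mv_def del: free_mv_simps)
  have "carrier (free_mv n) \<subseteq> carrier (mv_power (cube n))"
    using mcnaughton_subalgebra unfolding mv_subalgebra_def free_mv_simps by blast
  then show ?thesis
    using assms unfolding mv_hom_def ops by blast
qed

lemma semisimple_free: "semisimple_mv_algebra (free_mv n)"
proof (rule semisimple_mv_algebraI[OF mv_algebra_free, where e = id])
  show "id \<in> mv_hom (free_mv n) (mv_power (cube n))"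
    by (rule mv_hom_free_power) (simp add: mv_hom_def)
qed simp

text \<open>The operations are pointwise and therefore commute with precomposition. Homomorphisms
  out of the free algebra are built from such substitutions.\<close>

lemma substitution_hom:
  assumes p: "p \<in> X \<rightarrow> cube n"
  shows "(\<lambda>f. \<lambda>x\<in>X. f (p x)) \<in> mv_hom (free_mv n) (mv_power X)"
proof -
  have px: "p x \<in> cube n" if "x \<in> X" for x using p that by auto
  show ?thesis
    using mcnaughton_range px by (auto simp: mv_hom_def mv_power_def)
qed

text \<open>The uniqueness half of freeness: by McNaughton's theorem the projections generate
  everything.\<close>

lemma free_hom_eqI:
  assumes "h \<in> mv_hom (free_mv n) B" "k \<in> mv_hom (free_mv n) B"
    and "\<And>i. i \<in> {1..n} \<Longrightarrow> h (free_gen n i) = k (free_gen n i)" and "f \<in> mcnaughton n"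
  shows "h f = k f"
  by (rule mv_hom_eq_on_generate[OF mv_algebra_free assms(1,2) free_gens_closed])
    (use assms(3,4) mv_generate_free in auto)

text \<open>The existence half of freeness. Semisimplicity embeds \<open>A\<close> into a power of
  [0,1]; the images of the \<open>a i\<close> are then the coordinates of a map \<open>p\<close>
  into the cube, and substituting \<open>p\<close> sends the i-th projection to
  \<open>e (a i)\<close>. The result stays inside the image of \<open>A\<close> and can be pulled
  back along \<open>e\<close>.\<close>

lemma free_mv_extend:
  fixes A :: "('a, 'm) mv_scheme"
  assumes A: "semisimple_mv_algebra A" and a: "\<And>i. i \<in> {1..n} \<Longrightarrow> a i \<in> carrier A"
  obtains h where "h \<in> mv_hom (free_mv n) A" "\<And>i. i \<in> {1..n} \<Longrightarrow> h (free_gen n i) = a i"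
proof -
  note alg = semisimple_imp_mv_algebra[OF A]
  obtain X :: "('a \<Rightarrow> real) set" and e
    where e: "e \<in> mv_hom A (mv_power X)" and inj: "inj_on e (carrier A)"
    using semisimple_embedding[OF A] by blast
  define p where "p x = (\<lambda>i\<in>{1..n}. e (a i) x)" for x
  define k where "k f = (\<lambda>x\<in>X. f (p x))" for f :: "(nat \<Rightarrow> real) \<Rightarrow> real"
  have ea: "e (a i) \<in> X \<rightarrow>\<^sub>E {0..1}" if "i \<in> {1..n}" for i
    using mv_hom_closed[OF e a[OF that]] by (simp add: mv_power_def)
  have p: "p x \<in> cube n" if "x \<in> X" for x
  proof -
    have "e (a i) x \<in> {0..1}" if "i \<in> {1..n}" for i
      using PiE_mem[OF ea[OF that] \<open>x \<in> X\<close>] .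
    then show ?thesis by (simp add: p_def cube_def)
  qed
  have k: "k \<in> mv_hom (free_mv n) (mv_power X)"
    using substitution_hom[of p X n] p by (auto simp: k_def[abs_def])
  have kg: "k (free_gen n i) = e (a i)" if "i \<in> {1..n}" for i
  proof -
    have "k (free_gen n i) = restrict (e (a i)) X"
      unfolding k_def
    proof (rule restrict_ext)
      fix x assume "x \<in> X"
      then show "free_gen n i (p x) = e (a i) x"
        using p[of x] that by (simp add: free_gen_def) (simp add: p_def)
    qed
    then show ?thesis using PiE_restrict[OF ea[OF that]] by simp
  qed
  \<comment> \<open>McNaughton's theorem again: the whole image is generated by the images of the
    projections, so it cannot leave the image of \<open>A\<close>.\<close>
  have "k ` carrier (free_mv n) = e ` mv_generate A (a ` {1..n})"
  proof -
    have "k ` carrier (free_mv n) = mv_generate (mv_power X) (k ` free_gen n ` {1..n})"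
      using mv_hom_image_generate[OF mv_algebra_free k free_gens_closed] mv_generate_free by simp
    also have "k ` free_gen n ` {1..n} = e ` a ` {1..n}"
      using kg by (simp add: image_image del: One_nat_def)
    also have "mv_generate (mv_power X) \<dots> = e ` mv_generate A (a ` {1..n})"
      using mv_hom_image_generate[OF alg e, of "a ` {1..n}"] a by blast
    finally show ?thesis .
  qed
  also have "\<dots> \<subseteq> e ` carrier A"
    using mv_generate_closed[OF alg, of "a ` {1..n}"] a by blast
  finally have "(\<lambda>f. inv_into (carrier A) e (k f)) \<in> mv_hom (free_mv n) A"
    by (intro mv_hom_lift[OF alg e inj k] mv_algebra_free)
  moreover have "inv_into (carrier A) e (k (free_gen n i)) = a i" if "i \<in> {1..n}" for i
    using kg[OF that] a[OF that] inj by simp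
  ultimately show ?thesis by (rule that)
qed

text \<open>At the origin an integral affine form reduces to its integer constant term, and the only
  integers in [0,1] are 0 and 1.\<close>

lemma mcnaughton_origin:
  assumes "f \<in> mcnaughton n"
  shows "f (origin n) = 0 \<or> f (origin n) = 1"
proof -
  have o: "origin n \<in> cube n" by (auto simp: origin_def cube_def)
  moreover obtain P :: "(int \<times> (nat \<Rightarrow> int)) set" where
    "\<forall>x\<in>cube n. \<exists>(b, c)\<in>P. f x = of_int b + (\<Sum>i=1..n. of_int (c i) * x i)"
    using assms unfolding mcnaughton_def by blast
  ultimately obtain b :: int and c :: "nat \<Rightarrow> int"
    where "f (origin n) = of_int b + (\<Sum>i=1..n. of_int (c i) * origin n i)"
    by fast
  then have "f (origin n) = of_int b" by (simp add: origin_def)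
  moreover from this have "0 \<le> b" "b \<le> 1" using mcnaughton_range[OF assms o] by auto
  ultimately show ?thesis by (cases "b = 0") auto
qed

section \<open>Endomorphisms of the free algebra as self-maps of the cube\<close>

definition endo_map :: "nat \<Rightarrow> (((nat \<Rightarrow> real) \<Rightarrow> real) \<Rightarrow> (nat \<Rightarrow> real) \<Rightarrow> real) \<Rightarrow>
    (nat \<Rightarrow> real) \<Rightarrow> nat \<Rightarrow> real" where
  "endo_map n \<phi> u = (\<lambda>i\<in>{1..n}. \<phi> (free_gen n i) u)"

context
  fixes n :: nat and \<phi>
  assumes \<phi>: "\<phi> \<in> mv_hom (free_mv n) (free_mv n)"
begin

lemma endo_gen_closed: "i \<in> {1..n} \<Longrightarrow> \<phi> (free_gen n i) \<in> mcnaughton n"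
  using mv_hom_closed[OF \<phi>] free_gen_mcnaughton by simp

lemma endo_map_cube: "u \<in> cube n \<Longrightarrow> endo_map n \<phi> u \<in> cube n"
  using mcnaughton_range[OF endo_gen_closed] by (simp add: endo_map_def cube_def)

text \<open>Both \<open>\<phi>\<close> and substitution of \<open>endo_map n \<phi>\<close> are
  homomorphisms into the power over the cube, and they agree on the projections.\<close>

lemma endo_apply:
  assumes f: "f \<in> mcnaughton n" and u: "u \<in> cube n"
  shows "\<phi> f u = f (endo_map n \<phi> u)"
proof -
  let ?k = "\<lambda>f. \<lambda>u\<in>cube n. f (endo_map n \<phi> u)"
  have "\<phi> \<in> mv_hom (free_mv n) (mv_power (cube n))"
    by (rule mv_hom_free_power[OF \<phi>])
  moreover have "?k \<in> mv_hom (free_mv n) (mv_power (cube n))"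
    using endo_map_cube by (intro substitution_hom) auto
  moreover have "\<phi> (free_gen n i) = ?k (free_gen n i)" if "i \<in> {1..n}" for i
  proof -
    have "restrict (\<phi> (free_gen n i)) (cube n) = ?k (free_gen n i)"
    proof (rule restrict_ext)
      fix u assume "u \<in> cube n"
      then have "free_gen n i (endo_map n \<phi> u) = endo_map n \<phi> u i"
        by (intro free_gen_apply endo_map_cube)
      then show "\<phi> (free_gen n i) u = free_gen n i (endo_map n \<phi> u)"
        using that by (simp add: endo_map_def)
    qed
    then show ?thesis using mcnaughton_restrict[OF endo_gen_closed[OF that]] by simp
  qed
  ultimately have "\<phi> f = ?k f" using f by (rule free_hom_eqI)
  then show ?thesis using u by simp
qed

text \<open>Write d for \<open>endo_map n \<phi>\<close>; the equalizer consists of its fixed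
  points. If \<open>\<phi>\<close> is idempotent, so is d, and d(u) is the required point for u.
  Conversely, a fixed point x with d(u) = d(x) gives d(u) = x, so d(d(u)) = d(u), and substitution
  of d is idempotent.\<close>

lemma endo_idempotent_iff:
  "(\<forall>f\<in>mcnaughton n. \<phi> (\<phi> f) = \<phi> f) \<longleftrightarrow>
   (\<forall>u\<in>cube n. \<exists>x\<in>equalizer n (\<lambda>i. \<phi> (free_gen n i)).
      \<forall>i\<in>{1..n}. \<phi> (free_gen n i) u = \<phi> (free_gen n i) x)"
proof (intro iffI ballI)
  fix u assume idem: "\<forall>f\<in>mcnaughton n. \<phi> (\<phi> f) = \<phi> f" and u: "u \<in> cube n"
  have eq: "\<phi> (free_gen n i) u = \<phi> (free_gen n i) (endo_map n \<phi> u)" if i: "i \<in> {1..n}" for i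
    using endo_apply[OF endo_gen_closed[OF i] u] idem free_gen_mcnaughton[OF i] by simp
  moreover have "endo_map n \<phi> u \<in> equalizer n (\<lambda>i. \<phi> (free_gen n i))"
    unfolding equalizer_def
  proof (intro CollectI conjI ballI endo_map_cube u)
    fix i assume i: "i \<in> {1..n}"
    have "\<phi> (free_gen n i) (endo_map n \<phi> u) = endo_map n \<phi> u i"
      using eq[OF i] i by (simp add: endo_map_def)
    then show "\<phi> (free_gen n i) (endo_map n \<phi> u) = free_gen n i (endo_map n \<phi> u)"
      by (simp add: free_gen_apply endo_map_cube u)
  qed
  ultimately show "\<exists>x\<in>equalizer n (\<lambda>i. \<phi> (free_gen n i)).
      \<forall>i\<in>{1..n}. \<phi> (free_gen n i) u = \<phi> (free_gen n i) x"
    by blast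
next
  fix f
  assume eq: "\<forall>u\<in>cube n. \<exists>x\<in>equalizer n (\<lambda>i. \<phi> (free_gen n i)).
      \<forall>i\<in>{1..n}. \<phi> (free_gen n i) u = \<phi> (free_gen n i) x" and f: "f \<in> mcnaughton n"
  have \<phi>f: "\<phi> f \<in> mcnaughton n" using mv_hom_closed[OF \<phi>] f by simp
  have "\<phi> (\<phi> f) u = \<phi> f u" if u: "u \<in> cube n" for u
  proof -
    obtain x where x: "x \<in> equalizer n (\<lambda>i. \<phi> (free_gen n i))"
      and "\<forall>i\<in>{1..n}. \<phi> (free_gen n i) u = \<phi> (free_gen n i) x"
      using eq u by blast
    then have ux: "endo_map n \<phi> u = endo_map n \<phi> x"
      unfolding endo_map_def by (intro restrict_ext) blast
    have x': "x \<in> cube n" "\<And>i. i \<in> {1..n} \<Longrightarrow> \<phi> (free_gen n i) x = x i"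
      using x by (simp_all add: equalizer_def free_gen_apply)
    then have "endo_map n \<phi> x = restrict x {1..n}"
      unfolding endo_map_def by (intro restrict_ext)
    also have "\<dots> = x" using x'(1) unfolding cube_def by (rule PiE_restrict)
    finally have "endo_map n \<phi> x = x" .
    then show ?thesis
      using endo_apply[OF \<phi>f u] endo_apply[OF f u] endo_apply[OF f x'(1)] ux by metis
  qed
  moreover have "\<phi> (\<phi> f) \<in> mcnaughton n" using mv_hom_closed[OF \<phi>] \<phi>f by simp
  ultimately show "\<phi> (\<phi> f) = \<phi> f"
    by (metis mcnaughton_restrict[OF \<phi>f] mcnaughton_restrict restrict_ext)
qed

end


section \<open>Copies in infinite types\<close>

text \<open>Formal terms serve for counting: there are countably many, and each generated element is
  the value of one.\<close>

datatype mv_term = Gen nat | Zero | Neg mv_term | Plus mv_term mv_term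

instance mv_term :: countable
  by countable_datatype

primrec term_value :: "('a, 'm) mv_scheme \<Rightarrow> (nat \<Rightarrow> 'a) \<Rightarrow> mv_term \<Rightarrow> 'a" where
  "term_value A a (Gen i) = a i"
| "term_value A a Zero = mzero A"
| "term_value A a (Neg t) = mneg A (term_value A a t)"
| "term_value A a (Plus s t) = mplus A (term_value A a s) (term_value A a t)"

lemma countable_mv_generate: "countable (mv_generate A (a ` (I :: nat set)))"
proof -
  have "x \<in> range (term_value A a)" if "x \<in> mv_generate A (a ` I)" for x
    using that
  proof induction
    case (gen x)
    then obtain i where "x = term_value A a (Gen i)" by auto
    then show ?case by blast
  next
    case zero
    have "mzero A = term_value A a Zero" by simp
    then show ?case by blast
  next
    case (neg x)
    then obtain t where "x = term_value A a t" by blast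
    then have "mneg A x = term_value A a (Neg t)" by simp
    then show ?case by blast
  next
    case (plus x y)
    then obtain s t where "x = term_value A a s" "y = term_value A a t" by blast
    then have "mplus A x y = term_value A a (Plus s t)" by simp
    then show ?case by blast
  qed
  then have "mv_generate A (a ` I) \<subseteq> range (term_value A a)" by blast
  then show ?thesis by (rule countable_subset) simp
qed

text \<open>The structure is transported along an injection of the carrier into the naturals and
  from there into \<open>'b\<close>. This brings \<open>A\<close> and the free algebra into the
  types over which projectivity quantifies. Composing the inverse with an embedding of
  \<open>A\<close> into a power shows that the copy is semisimple.\<close>

lemma countable_copy:
  fixes A :: "('a, 'm) mv_scheme"
  assumes A: "semisimple_mv_algebra A" and count: "countable (carrier A)"
  obtains B :: "'b::infinite mv" and j k
  where "semisimple_mv_algebra B" "j \<in> mv_hom A B" "k \<in> mv_hom B A"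
    "\<And>x. x \<in> carrier A \<Longrightarrow> k (j x) = x" "\<And>y. y \<in> carrier B \<Longrightarrow> j (k y) = y"
proof -
  interpret mv_algebra A using A by (rule semisimple_imp_mv_algebra)
  obtain f :: "nat \<Rightarrow> 'b" where f: "inj f"
    using infinite_countable_subset[OF infinite_UNIV] by blast
  obtain to :: "'a \<Rightarrow> nat" where to: "inj_on to (carrier A)"
    using count by (auto simp: countable_def)
  define j where "j = f \<circ> to"
  define k where "k = inv_into (carrier A) j"
  have j: "inj_on j (carrier A)"
    unfolding j_def using to f by (metis comp_inj_on inj_on_subset top_greatest)
  have kj: "k (j x) = x" if "x \<in> carrier A" for x using j that by (simp add: k_def)
  define B :: "'b mv" where "B = \<lparr>carrier = j ` carrier A,
    mplus = (\<lambda>x y. j (mplus A (k x) (k y))), mneg = (\<lambda>x. j (mneg A (k x))), mzero = j (mzero A)\<rparr>"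
  have jh: "j \<in> mv_hom A B" by (auto simp: mv_hom_def B_def kj)
  have kh: "k \<in> mv_hom B A"
    using zero_closed neg_closed plus_closed by (auto simp: mv_hom_def B_def kj)
  have jk: "j (k y) = y" if "y \<in> carrier B" for y
    using that by (auto simp: B_def kj)
  have alg: "mv_algebra B"
    by unfold_locales
      (auto simp: B_def kj zero_closed neg_closed plus_closed plus_assoc plus_zero neg_neg plus_one
        luk, metis plus_comm)
  obtain X :: "('a \<Rightarrow> real) set" and e
    where e: "e \<in> mv_hom A (mv_power X)" "inj_on e (carrier A)"
    using semisimple_embedding[OF A] by blast
  have "semisimple_mv_algebra B"
  proof (rule semisimple_mv_algebraI[OF alg mv_hom_compose[OF kh e(1)]])
    show "inj_on (e \<circ> k) (carrier B)"
      using e(2) by (auto simp: inj_on_def B_def kj)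
  qed
  then show ?thesis using that jh kh kj jk by blast
qed


section \<open>Projective algebras are the retracts of the free algebra\<close>

definition free_retract :: "nat \<Rightarrow> ('a, 'm) mv_scheme \<Rightarrow>
    (((nat \<Rightarrow> real) \<Rightarrow> real) \<Rightarrow> 'a) \<Rightarrow> ('a \<Rightarrow> (nat \<Rightarrow> real) \<Rightarrow> real) \<Rightarrow> bool" where
  "free_retract n A q s \<longleftrightarrow> q \<in> mv_hom (free_mv n) A \<and> s \<in> mv_hom A (free_mv n) \<and>
     (\<forall>x\<in>carrier A. q (s x) = x)"

text \<open>Generators of \<open>A\<close> yield a surjection \<open>q\<close> from the free
  algebra, and lifting the identity of \<open>A\<close> along \<open>q\<close> would give the
  section \<open>s\<close>. The lifting is carried out on copies of \<open>A\<close> in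
  \<open>'b\<close> and of the free algebra in \<open>'c\<close>.\<close>

lemma projective_imp_retract:
  fixes A :: "('a, 'm) mv_scheme"
  assumes A: "semisimple_mv_algebra A" and gen: "n_generated n A"
    and proj: "projective TYPE('b::infinite) TYPE('c::infinite) A"
  obtains q s where "free_retract n A q s"
proof -
  obtain a where a: "a \<in> {1..n} \<rightarrow> carrier A" "mv_generate A (a ` {1..n}) = carrier A"
    using gen by (auto simp: n_generated_def)
  then obtain q where q: "q \<in> mv_hom (free_mv n) A" "\<And>i. i \<in> {1..n} \<Longrightarrow> q (free_gen n i) = a i"
    using free_mv_extend[of A n a] A by blast
  have "q ` free_gen n ` {1..n} = a ` {1..n}"
    using q(2) by (simp add: image_image del: One_nat_def)
  then have q_onto: "q ` mcnaughton n = carrier A"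
    using mv_hom_image_generate[OF mv_algebra_free q(1) free_gens_closed] a(2)
    by (simp add: mv_generate_free del: One_nat_def)
  obtain B :: "'b mv" and jB kB where B: "semisimple_mv_algebra B"
    "jB \<in> mv_hom A B" "kB \<in> mv_hom B A" "\<And>x. x \<in> carrier A \<Longrightarrow> kB (jB x) = x"
    "\<And>y. y \<in> carrier B \<Longrightarrow> jB (kB y) = y"
    using countable_copy[OF A] countable_mv_generate[of A a "{1..n}"] a(2) by metis
  obtain C :: "'c mv" and jC kC where C: "semisimple_mv_algebra C"
    "jC \<in> mv_hom (free_mv n) C" "kC \<in> mv_hom C (free_mv n)" "\<And>x. x \<in> mcnaughton n \<Longrightarrow> kC (jC x) = x"
    "\<And>y. y \<in> carrier C \<Longrightarrow> jC (kC y) = y"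
    using countable_copy[OF semisimple_free, of n] countable_mv_generate[of "free_mv n" "free_gen n" "{1..n}"]
    unfolding mv_generate_free free_mv_simps by metis
  \<comment> \<open>This is \<open>q\<close> transported to the copies; the map to be lifted along
    it is \<open>jB\<close>, in place of the identity of \<open>A\<close>.\<close>
  define g where "g = jB \<circ> (q \<circ> kC)"
  have g: "g \<in> mv_hom C B"
    unfolding g_def by (intro mv_hom_compose[of _ _ A] mv_hom_compose[of _ _ "free_mv n"] B C q)
  have "carrier B \<subseteq> g ` carrier C"
  proof
    fix y assume y: "y \<in> carrier B"
    then have "kB y \<in> carrier A" using B(3) by (rule mv_hom_closed[rotated])
    then obtain f where f: "f \<in> mcnaughton n" "kB y = q f" using q_onto by blast
    then have "g (jC f) = y" using C(4) B(5)[OF y] by (simp add: g_def)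
    moreover have "jC f \<in> carrier C" using mv_hom_closed[OF C(2)] f by simp
    ultimately show "y \<in> g ` carrier C" by blast
  qed
  then have "g \<in> mv_epi C B" using g mv_hom_closed[OF g] by (auto simp: mv_epi_def)
  then obtain h where h: "h \<in> mv_hom A C" "\<And>x. x \<in> carrier A \<Longrightarrow> g (h x) = jB x"
    using proj B(1,2) C(1) unfolding projective_def by blast
  have "q (kC (h x)) = x" if x: "x \<in> carrier A" for x
  proof -
    have "q (kC (h x)) \<in> carrier A"
      by (rule mv_hom_closed[OF q(1) mv_hom_closed[OF C(3) mv_hom_closed[OF h(1) x]]])
    then show ?thesis using h(2)[OF x] B(4) x by (metis comp_apply g_def)
  qed
  then have "free_retract n A q (kC \<circ> h)"
    using q(1) mv_hom_compose[OF h(1) C(3)] by (simp add: free_retract_def)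
  then show ?thesis by (rule that)
qed

text \<open>The free algebra is projective: preimages under \<open>g\<close> of the values of
  \<open>f \<circ> q\<close> on the projections extend to some \<open>k\<close> with
  \<open>g \<circ> k = f \<circ> q\<close>. Composing \<open>k\<close> with the section
  \<open>s\<close> then lifts \<open>f\<close>.\<close>

lemma retract_imp_projective:
  assumes r: "free_retract n A q s"
  shows "projective TYPE('b::infinite) TYPE('c::infinite) A"
  unfolding projective_def
proof (intro allI impI ballI)
  fix B :: "'b mv" and C :: "'c mv" and g f
  assume C: "semisimple_mv_algebra C" and g: "g \<in> mv_epi C B" and f: "f \<in> mv_hom A B"
  have q: "q \<in> mv_hom (free_mv n) A" and s: "s \<in> mv_hom A (free_mv n)"
    and qs: "\<And>x. x \<in> carrier A \<Longrightarrow> q (s x) = x"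
    using r by (auto simp: free_retract_def)
  have g': "g \<in> mv_hom C B" "g ` carrier C = carrier B" using g by (auto simp: mv_epi_def)
  have "\<exists>c\<in>carrier C. g c = f (q (free_gen n i))" if "i \<in> {1..n}" for i
  proof -
    have "f (q (free_gen n i)) \<in> carrier B"
      using mv_hom_closed[OF mv_hom_compose[OF q f], of "free_gen n i"] free_gen_mcnaughton[OF that]
      by simp
    then show ?thesis using g'(2) by (metis imageE)
  qed
  then obtain c where c: "\<And>i. i \<in> {1..n} \<Longrightarrow> c i \<in> carrier C"
    "\<And>i. i \<in> {1..n} \<Longrightarrow> g (c i) = f (q (free_gen n i))"
    by metis
  obtain k where k: "k \<in> mv_hom (free_mv n) C" "\<And>i. i \<in> {1..n} \<Longrightarrow> k (free_gen n i) = c i"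
    using free_mv_extend[of C n c] C c(1) by blast
  have "(g \<circ> k) x = (f \<circ> q) x" if "x \<in> mcnaughton n" for x
    by (rule free_hom_eqI[OF mv_hom_compose[OF k(1) g'(1)] mv_hom_compose[OF q f] _ that])
      (simp add: k c del: One_nat_def)
  then have "\<forall>x\<in>carrier A. g ((k \<circ> s) x) = f x"
    using qs mv_hom_closed[OF s] by simp
  then show "\<exists>h\<in>mv_hom A C. \<forall>x\<in>carrier A. g (h x) = f x"
    using mv_hom_compose[OF s k(1)] by blast
qed

text \<open>The induced retraction \<open>\<delta>\<close> of the cube sends the origin to a vertex \<open>v\<close>.  Conjugating with
  the reflection of the cube that exchanges the origin and \<open>v\<close> gives a retraction that
  fixes the origin.\<close>

lemma retract_normalise:
  assumes r: "free_retract n A q s"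
  obtains q' s' where "free_retract n A q' s'"
    "\<And>i. i \<in> {1..n} \<Longrightarrow> s' (q' (free_gen n i)) (origin n) = 0"
proof -
  have q: "q \<in> mv_hom (free_mv n) A" and s: "s \<in> mv_hom A (free_mv n)"
    and qs: "\<And>x. x \<in> carrier A \<Longrightarrow> q (s x) = x"
    using r by (auto simp: free_retract_def)
  have o: "origin n \<in> cube n" by (auto simp: origin_def cube_def)
  define \<phi> where "\<phi> = s \<circ> q"
  have \<phi>: "\<phi> \<in> mv_hom (free_mv n) (free_mv n)"
    unfolding \<phi>_def by (rule mv_hom_compose[OF q s])
  have idem: "\<phi> (\<phi> f) = \<phi> f" if "f \<in> mcnaughton n" for f
    using that qs mv_hom_closed[OF q] by (simp add: \<phi>_def)
  define v where "v = endo_map n \<phi> (origin n)"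
  have v: "v \<in> cube n" unfolding v_def using endo_map_cube[OF \<phi> o] .
  have v01: "v i = 0 \<or> v i = 1" if "i \<in> {1..n}" for i
    using mcnaughton_origin[OF endo_gen_closed[OF \<phi> that]] that
    by (simp add: v_def endo_map_def)
  \<comment> \<open>By idempotence the vertex \<open>v\<close>, being an image point of the
    retraction, is fixed by it.\<close>
  have \<phi>v: "\<phi> (free_gen n i) v = v i" if i: "i \<in> {1..n}" for i
    using endo_apply[OF \<phi> endo_gen_closed[OF \<phi> i] o] idem[OF free_gen_mcnaughton[OF i]] i
    by (simp add: v_def endo_map_def)
  \<comment> \<open>The coordinates of the reflection: exactly those coordinates in which
    \<open>v\<close> is 1 are flipped.\<close>
  define r where "r i = (if v i = 1 then mneg (free_mv n) (free_gen n i) else free_gen n i)" for i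
  interpret mv_algebra "free_mv n" by (rule mv_algebra_free)
  have r_closed: "r i \<in> carrier (free_mv n)" if "i \<in> {1..n}" for i
    using neg_closed free_gen_mcnaughton[OF that] by (simp add: r_def)
  obtain \<sigma> where \<sigma>: "\<sigma> \<in> mv_hom (free_mv n) (free_mv n)"
    and \<sigma>g: "\<And>i. i \<in> {1..n} \<Longrightarrow> \<sigma> (free_gen n i) = r i"
    using free_mv_extend[of "free_mv n" n r] semisimple_free r_closed by blast
  \<comment> \<open>Checked on projections, where it is double negation.\<close>
  have \<sigma>\<sigma>: "\<sigma> (\<sigma> f) = f" if "f \<in> mcnaughton n" for f
  proof -
    have "id \<in> mv_hom (free_mv n) (free_mv n)" by (simp add: mv_hom_def)
    moreover have "(\<sigma> \<circ> \<sigma>) (free_gen n i) = id (free_gen n i)" if i: "i \<in> {1..n}" for i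
    proof -
      have g: "free_gen n i \<in> carrier (free_mv n)" using free_gen_mcnaughton[OF i] by simp
      then have "\<sigma> (mneg (free_mv n) (free_gen n i)) = mneg (free_mv n) (r i)"
        using \<sigma> \<sigma>g[OF i] by (simp add: mv_hom_def del: free_mv_simps(2-))
      then show ?thesis
        using neg_neg[OF g] \<sigma>g[OF i] by (simp add: r_def del: free_mv_simps split: if_splits)
    qed
    ultimately have "(\<sigma> \<circ> \<sigma>) f = id f"
      using free_hom_eqI[OF mv_hom_compose[OF \<sigma> \<sigma>]] that by blast
    then show ?thesis by simp
  qed
  have \<sigma>o: "endo_map n \<sigma> (origin n) = v"
  proof
    fix i
    show "endo_map n \<sigma> (origin n) i = v i"
    proof (cases "i \<in> {1..n}")
      case True
      then show ?thesis
        using v01[OF True] \<sigma>g[OF True] o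
        by (auto simp: endo_map_def r_def free_gen_def origin_def)
    next
      case False
      then show ?thesis by (simp only: v_def endo_map_def restrict_apply if_False)
    qed
  qed
  \<comment> \<open>The two copies of \<open>\<sigma>\<close> cancel in the middle, leaving
    \<open>q (s x)\<close>.\<close>
  have "free_retract n A (q \<circ> \<sigma>) (\<sigma> \<circ> s)"
    using mv_hom_compose[OF \<sigma> q] mv_hom_compose[OF s \<sigma>] qs mv_hom_closed[OF s] \<sigma>\<sigma>
    by (simp add: free_retract_def)
  \<comment> \<open>Evaluating at the origin after \<open>\<sigma>\<close> means evaluating at
    \<open>v\<close>. As \<open>v\<close> is fixed by the retraction, the value is that of
    \<open>r i\<close> at \<open>v\<close>, namely 0 by the choice of \<open>r\<close>.\<close>
  moreover have "(\<sigma> \<circ> s) ((q \<circ> \<sigma>) (free_gen n i)) (origin n) = 0" if i: "i \<in> {1..n}" for i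
  proof -
    have \<phi>r: "\<phi> (r i) \<in> mcnaughton n" using mv_hom_closed[OF \<phi> r_closed[OF i]] by simp
    have "(\<sigma> \<circ> s) ((q \<circ> \<sigma>) (free_gen n i)) (origin n) = \<sigma> (\<phi> (r i)) (origin n)"
      using \<sigma>g[OF i] by (simp add: \<phi>_def)
    also have "\<dots> = \<phi> (r i) v" using endo_apply[OF \<sigma> \<phi>r o] \<sigma>o by simp
    also have "\<dots> = 0"
    proof (cases "v i = 1")
      case True
      then have "\<phi> (r i) = mneg (free_mv n) (\<phi> (free_gen n i))"
        using \<phi> free_gen_mcnaughton[OF i] by (simp add: r_def mv_hom_def)
      then show ?thesis using \<phi>v[OF i] True v by simp
    next
      case False
      then show ?thesis using \<phi>v[OF i] v01[OF i] by (simp add: r_def)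
    qed
    finally show ?thesis .
  qed
  ultimately show ?thesis by (rule that)
qed

section \<open>Projectivity and the equalizer condition\<close>

theorem corollary2p5:
  fixes A :: "'a mv" and n :: nat
  assumes "semisimple_mv_algebra A" and "n_generated n A"
  shows "projective TYPE('b::infinite) TYPE('c::infinite) A \<longleftrightarrow>
    (\<exists>B. mv_subalgebra B (free_mv n) \<and>
       mv_isomorphic A ((free_mv n)\<lparr>carrier := B\<rparr>) \<and>
       (\<exists>\<phi> \<in> mv_epi (free_mv n) ((free_mv n)\<lparr>carrier := B\<rparr>).
          let d = (\<lambda>i. \<phi> (free_gen n i)); K = equalizer n d in
            (\<forall>i\<in>{1..n}. d i (origin n) = 0) \<and>
            (\<forall>u\<in>cube n. \<exists>x\<in>K. \<forall>i\<in>{1..n}. d i u = d i x)))"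
    (is "?P \<longleftrightarrow> (\<exists>B. ?Q B)")
proof
  note alg = semisimple_imp_mv_algebra[OF assms(1)]
  assume ?P
  \<comment> \<open>The normalised retract supplies the requirement that the \<open>d i\<close>
    vanish at the origin.\<close>
  then obtain q s where r: "free_retract n A q s"
    and zero: "\<And>i. i \<in> {1..n} \<Longrightarrow> s (q (free_gen n i)) (origin n) = 0"
    using projective_imp_retract[OF assms] retract_normalise by metis
  have q: "q \<in> mv_hom (free_mv n) A" and s: "s \<in> mv_hom A (free_mv n)"
    and qs: "\<And>x. x \<in> carrier A \<Longrightarrow> q (s x) = x"
    using r by (auto simp: free_retract_def)
  let ?B = "s ` carrier A"
  have "mv_subalgebra ?B (free_mv n)" by (rule mv_subalgebra_hom_image[OF alg s])
  moreover have sB: "s \<in> mv_hom A ((free_mv n)\<lparr>carrier := ?B\<rparr>)"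
    using s by (auto simp: mv_hom_def)
  moreover have "bij_betw s (carrier A) ?B"
    using qs by (auto simp: bij_betw_def intro: inj_on_inverseI)
  moreover have "s \<circ> q \<in> mv_epi (free_mv n) ((free_mv n)\<lparr>carrier := ?B\<rparr>)"
  proof -
    have "q ` carrier (free_mv n) = carrier A"
      using mv_hom_closed[OF q] mv_hom_closed[OF s] qs by force
    then have "(s \<circ> q) ` carrier (free_mv n) = ?B" by (metis image_comp)
    then show ?thesis
      using mv_hom_compose[OF q sB] by (simp add: mv_epi_def)
  qed
  \<comment> \<open>Since \<open>q \<circ> s\<close> is the identity on \<open>A\<close>,
    \<open>s \<circ> q\<close> is idempotent; \<open>endo_idempotent_iff\<close> turns this into the
    condition on the equalizer.\<close>
  moreover have "\<forall>f\<in>mcnaughton n. (s \<circ> q) ((s \<circ> q) f) = (s \<circ> q) f"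
    using qs mv_hom_closed[OF q] by simp
  ultimately have "?Q ?B"
    using zero endo_idempotent_iff[OF mv_hom_compose[OF q s]]
    unfolding mv_isomorphic_def Let_def by (intro conjI bexI[of _ s] bexI[of _ "s \<circ> q"]) simp_all
  then show "\<exists>B. ?Q B" ..
next
  note alg = semisimple_imp_mv_algebra[OF assms(1)]
  assume "\<exists>B. ?Q B"
  then obtain B where sub: "mv_subalgebra B (free_mv n)"
    and iso: "mv_isomorphic A ((free_mv n)\<lparr>carrier := B\<rparr>)" and Q: "?Q B"
    by blast
  let ?B = "(free_mv n)\<lparr>carrier := B\<rparr>"
  obtain \<phi> where epi: "\<phi> \<in> mv_epi (free_mv n) ?B"
    and eq: "\<forall>u\<in>cube n. \<exists>x\<in>equalizer n (\<lambda>i. \<phi> (free_gen n i)).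
      \<forall>i\<in>{1..n}. \<phi> (free_gen n i) u = \<phi> (free_gen n i) x"
    using Q by (auto simp: Let_def)
  obtain m where m: "m \<in> mv_hom A ?B" and bij: "bij_betw m (carrier A) B"
    using iso by (auto simp: mv_isomorphic_def)
  have \<phi>B: "\<phi> \<in> mv_hom (free_mv n) ?B" "\<phi> ` mcnaughton n = B"
    using epi by (auto simp: mv_epi_def)
  have B: "B \<subseteq> mcnaughton n" using sub by (simp add: mv_subalgebra_def)
  have \<phi>: "\<phi> \<in> mv_hom (free_mv n) (free_mv n)"
    using \<phi>B(1) B by (auto simp: mv_hom_def)
  \<comment> \<open>Every element of \<open>B\<close> is a value of the idempotent
    \<open>\<phi>\<close>, hence fixed by it.\<close>
  have fix_B: "\<phi> f = f" if "f \<in> B" for f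
    using that endo_idempotent_iff[OF \<phi>] eq \<phi>B(2) by auto
  \<comment> \<open>Retract onto \<open>B\<close> by \<open>\<phi>\<close> and go back to
    \<open>A\<close> by the inverse of the isomorphism \<open>m\<close>; the section is
    \<open>m\<close> itself.\<close>
  let ?q = "\<lambda>f. inv_into (carrier A) m (\<phi> f)"
  have "?q \<in> mv_hom (free_mv n) A"
    using bij \<phi>B(2) by (intro mv_hom_lift[OF alg m _ \<phi>B(1)] mv_algebra_free) (auto simp: bij_betw_def)
  moreover have "m \<in> mv_hom A (free_mv n)" using m B by (auto simp: mv_hom_def)
  moreover have "?q (m x) = x" if "x \<in> carrier A" for x
    using bij that mv_hom_closed[OF m that] fix_B by (simp add: bij_betw_def)
  ultimately have "free_retract n A ?q m" by (simp add: free_retract_def)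
  then show ?P by (rule retract_imp_projective)
qed

end
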